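(* Let $d, m \in \mathbb{N}$, let $\boldsymbol{x} = (x_1,\dots,x_d) \in \mathcal{S}$, where $\mathcal{S} = \{\boldsymbol{x}\in[0,1]^d : \sum_{i=1}^d x_i \leq 1\}$, and let $\boldsymbol{\xi} = (\xi_1,\dots,\xi_d) \sim \mathrm{Multinomial}(m,\boldsymbol{x})$. Then, for all $p_1, p_2, \dots, p_d \in \mathbb{N}_0$, $$\mathbb{E}\Big[\prod_{i=1}^d \xi_i^{p_i}\Big] = \sum_{k_1=0}^{p_1} \cdots \sum_{k_d=0}^{p_d} m^{(\sum_{i=1}^d k_i)} \prod_{i=1}^d {p_i \brace k_i}\, x_i^{k_i},$$ where $m^{(k)}$ denotes the $k$-th order falling factorial of $m$ and ${p \brace k}$ denotes a Stirling number of the second kind.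
   Context: $\mathbb{N} = \{1,2,\dots\}$ and $\mathbb{N}_0 = \{0,1,2,\dots\}$. For $d,m\in\mathbb{N}$ and $\boldsymbol{x}\in\mathcal{S}$, the notation $\boldsymbol{\xi}=(\xi_1,\dots,\xi_d)\sim \mathrm{Multinomial}(m,\boldsymbol{x})$ means that $\boldsymbol{\xi}$ takes values in the set of $\boldsymbol{k}\in\mathbb{N}_0^d$ with $\sum_{i=1}^d k_i \leq m$ and has probability mass function $$P_{\boldsymbol{k},m}(\boldsymbol{x}) = \frac{m!}{(m-\sum_{i=1}^d k_i)!\,\prod_{i=1}^d k_i!}\,\Big(1-\sum_{i=1}^d x_i\Big)^{m-\sum_{i=1}^d k_i}\prod_{i=1}^d x_i^{k_i}.$$ (Thus only the first $d$ of the $d+1$ category counts are recorded; the remaining category has probability $1-\sum_{i=1}^d x_i$ and count $m-\sum_{i=1}^d \xi_i$.) The falling factorial is $m^{(k)} = m(m-1)\cdots(m-k+1)$ for $k\in\mathbb{N}_0$, with $m^{(0)}=1$ (so $m^{(k)}=0$ when $k>m$). The Stirling number of the second kind ${p \brace k}$ is the number of ways to partition a set of $p$ objects into $k$ non-empty subsets, with ${0 \brace 0}=1$. The convention $0^0=1$ is used throughout. *)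

theory Defs
  imports "HOL-Probability.Probability" "HOL-Combinatorics.Stirling"
begin

text \<open>Vectors of length \<open>d\<close> are functions on \<open>nat\<close> of which only the values at indices
  in \<open>{1..d}\<close> matter.\<close>

definition simplex_set :: "nat \<Rightarrow> (nat \<Rightarrow> real) set" where
  "simplex_set d = {x \<in> {1..d} \<rightarrow> {0..1}. (\<Sum>i\<in>{1..d}. x i) \<le> 1}"

definition multinomial_mass :: "nat \<Rightarrow> nat \<Rightarrow> (nat \<Rightarrow> real) \<Rightarrow> (nat \<Rightarrow> nat) \<Rightarrow> real" where
  "multinomial_mass d m x k =
     fact m / (fact (m - (\<Sum>i\<in>{1..d}. k i)) * (\<Prod>i\<in>{1..d}. fact (k i)))
       * (1 - (\<Sum>i\<in>{1..d}. x i)) ^ (m - (\<Sum>i\<in>{1..d}. k i))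
       * (\<Prod>i\<in>{1..d}. x i ^ k i)"

text \<open>Only the first \<open>d\<close> of the \<open>d + 1\<close> category counts are recorded. The natural-number
  subtraction in the mass function never truncates here, because the mass function is only
  used for \<open>k\<close> with total at most \<open>m\<close>.\<close>

definition multinomial_distributed ::
    "'a measure \<Rightarrow> nat \<Rightarrow> nat \<Rightarrow> (nat \<Rightarrow> real) \<Rightarrow> (nat \<Rightarrow> 'a \<Rightarrow> nat) \<Rightarrow> bool" where
  "multinomial_distributed M d m x \<xi> \<longleftrightarrow>
     (\<forall>i\<in>{1..d}. \<xi> i \<in> M \<rightarrow>\<^sub>M count_space UNIV) \<and>
     (AE \<omega> in M. (\<Sum>i\<in>{1..d}. \<xi> i \<omega>) \<le> m) \<and>
     (\<forall>k. (\<Sum>i\<in>{1..d}. k i) \<le> m \<longrightarrow>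
        measure M {\<omega> \<in> space M. \<forall>i\<in>{1..d}. \<xi> i \<omega> = k i} = multinomial_mass d m x k)"

definition falling_factorial :: "'a :: comm_ring_1 \<Rightarrow> nat \<Rightarrow> 'a" where
  "falling_factorial a k = (\<Prod>j<k. a - of_nat j)"

text \<open>The library introduces \<open>Stirling\<close> by its recurrence; it counts set partitions.\<close>

lemma card_partitions_eq_Stirling:
  assumes "finite A"
  shows "card {P. partition_on A P \<and> card P = k} = Stirling (card A) k"
  using assms
proof (induction A arbitrary: k rule: finite_induct)
  case empty
  have eq: "{P. partition_on {} P \<and> card P = k} = (if k = 0 then {{}} else {} :: 'a set set set)"
    by (auto simp: partition_on_empty)
  show ?case unfolding eq by (cases k) auto
next
  case (insert a A)
  have finP: "finite {P. partition_on B P \<and> card P = j}" if "finite B" for B :: "'a set" and j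
    by (rule finite_subset[of _ "Pow (Pow B)"]) (use that in \<open>auto simp: partition_on_def\<close>)
  have fin: "finite P" if "partition_on B P" "finite B" for B :: "'a set" and P
    using that by (meson finite_elements)
  show ?case
  proof (cases k)
    case 0
    have none: "{P. partition_on (insert a A) P \<and> card P = 0} = {}"
      using fin[of "insert a A"] insert.hyps by (fastforce simp: partition_on_def)
    show ?thesis unfolding 0 none using insert.hyps by simp
  next
    case (Suc j)
    let ?S = "\<lambda>B l. {P. partition_on B P \<and> card P = l}"
    let ?f = "\<lambda>(Q, X). insert (insert a X) (Q - {X})"
    let ?D = "SIGMA Q : ?S A (Suc j). Q"
    have 1: "?S (insert a A) (Suc j) = insert {a} ` ?S A j \<union> ?f ` ?D" (is "_ = ?L \<union> ?R")
    proof (intro equalityI subsetI)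
      fix P assume P: "P \<in> ?S (insert a A) (Suc j)"
      then have po: "partition_on (insert a A) P" and cP: "card P = Suc j" by auto
      from po obtain Y where Y: "Y \<in> P" "a \<in> Y" by (auto simp: partition_on_def)
      have dis: "Z \<inter> Y = {}" if "Z \<in> P" "Z \<noteq> Y" for Z
        using po Y(1) that by (auto simp: partition_on_def disjoint_def)
      have PY: "partition_on (insert a A - Y) (P - {Y})"
      proof -
        have "disjnt Y (\<Union>(P - {Y}))" using dis unfolding disjnt_def by blast
        moreover have "insert Y (P - {Y}) = P" using Y by blast
        ultimately show ?thesis using po partition_on_insert by metis
      qed
      have fP: "finite P" using po insert.hyps fin by blast
      show "P \<in> ?L \<union> ?R"
      proof (cases "Y = {a}")
        case True
        then have "partition_on A (P - {Y})" using PY insert.hyps by simp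
        moreover have "card (P - {Y}) = j" using cP Y by simp
        moreover have "P = insert {a} (P - {Y})" using True Y by auto
        ultimately show ?thesis by blast
      next
        case False
        define X where "X = Y - {a}"
        define Q where "Q = insert X (P - {Y})"
        have Xne: "X \<noteq> {}" using False Y by (auto simp: X_def)
        have XP: "X \<notin> P" using dis[of X] Xne Y by (auto simp: X_def)
        have YX: "Y = insert a X" using Y by (auto simp: X_def)
        have YA: "Y \<subseteq> insert a A" using po Y by (auto simp: partition_on_def)
        have "partition_on (X \<union> (insert a A - Y)) Q"
          unfolding partition_on_def
        proof (intro conjI)
          show "\<Union> Q = X \<union> (insert a A - Y)" using PY by (auto simp: Q_def partition_on_def)
          show "disjoint Q" unfolding Q_def pairwise_insert
          proof (intro conjI allI impI)
            show "disjoint (P - {Y})" using PY by (simp add: partition_on_def)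
          next
            fix Z assume "Z \<in> P - {Y} \<and> Z \<noteq> X"
            then have "Z \<inter> Y = {}" using dis[of Z] by auto
            then show "disjnt X Z" "disjnt Z X" by (auto simp: X_def disjnt_def)
          qed
          show "{} \<notin> Q" using Xne po by (auto simp: Q_def partition_on_def)
        qed
        moreover have "X \<union> (insert a A - Y) = A" using YA Y insert.hyps by (auto simp: X_def)
        ultimately have "partition_on A Q" by simp
        moreover have "card Q = Suc j" using cP fP Y XP by (simp add: Q_def card_Suc_Diff1)
        moreover have "P = ?f (Q, X)" using XP Y YX by (auto simp: Q_def)
        moreover have "X \<in> Q" by (simp add: Q_def)
        ultimately have "(Q, X) \<in> ?D" "P = ?f (Q, X)" by auto
        then show ?thesis by (meson UnI2 image_eqI)
      qed
    next
      fix P assume "P \<in> ?L \<union> ?R"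
      then show "P \<in> ?S (insert a A) (Suc j)"
      proof
        assume "P \<in> ?L"
        then obtain Q where Q: "partition_on A Q" "card Q = j" "P = insert {a} Q" by auto
        have "{a} \<notin> Q" using Q insert.hyps by (auto simp: partition_on_def)
        moreover have "partition_on (insert a A) P"
          using Q insert.hyps partition_on_insert[of "{a}" Q "insert a A"]
          by (auto simp: disjnt_def partition_on_def)
        ultimately show ?thesis using Q fin insert.hyps by simp
      next
        assume "P \<in> ?R"
        then obtain Q X where Q: "partition_on A Q" "card Q = Suc j" "X \<in> Q"
          "P = insert (insert a X) (Q - {X})" by auto
        have "insert a X \<notin> Q" using Q insert.hyps by (auto simp: partition_on_def)
        moreover have "partition_on (insert a A) P"
          unfolding partition_on_def
        proof (intro conjI)
          show "\<Union> P = insert a A" using Q by (auto simp: partition_on_def)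
          show "disjoint P" unfolding Q(4) pairwise_insert
          proof (intro conjI allI impI)
            show "disjoint (Q - {X})"
              using Q by (auto simp: partition_on_def pairwise_def)
          next
            fix Z assume Z: "Z \<in> Q - {X} \<and> Z \<noteq> insert a X"
            then have "disjnt Z X" using Q by (auto simp: partition_on_def pairwise_def)
            moreover have "a \<notin> Z" using Z Q insert.hyps by (auto simp: partition_on_def)
            ultimately show "disjnt (insert a X) Z" "disjnt Z (insert a X)"
              by (auto simp: disjnt_def)
          qed
          show "{} \<notin> P" using Q by (auto simp: partition_on_def)
        qed
        ultimately show ?thesis using Q fin[OF Q(1)] insert.hyps by (simp add: card_Suc_Diff1)
      qed
    qed
    have 2: "?L \<inter> ?R = {}"
    proof -
      have False if "partition_on A Q" "partition_on A Q'" "X \<in> Q'"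
        "insert {a} Q = insert (insert a X) (Q' - {X})" for Q Q' X
      proof -
        have "{a} = insert a X \<or> {a} \<in> Q'" using that(4) by auto
        moreover have "a \<notin> X" "X \<noteq> {}" "{a} \<notin> Q'"
          using that insert.hyps by (auto simp: partition_on_def)
        ultimately show False by auto
      qed
      then show ?thesis by (auto simp del: insert_iff simp: set_eq_iff[of _ "{}"])
    qed
    have i1: "inj_on (insert {a}) (?S A j)"
    proof (rule inj_onI)
      fix Q Q' assume "Q \<in> ?S A j" "Q' \<in> ?S A j" and eq: "insert {a} Q = insert {a} Q'"
      then have "{a} \<notin> Q" "{a} \<notin> Q'" using insert.hyps by (auto simp: partition_on_def)
      with eq show "Q = Q'" by (simp add: insert_ident)
    qed
    have i2: "inj_on ?f ?D"
    proof -
      have "Q = Q' \<and> X = X'" if "partition_on A Q" "partition_on A Q'" "X \<in> Q" "X' \<in> Q'"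
        and eq: "insert (insert a X) (Q - {X}) = insert (insert a X') (Q' - {X'})" for Q Q' X X'
      proof -
        have a: "a \<notin> Z" if "Z \<in> Q \<or> Z \<in> Q'" for Z
          using that \<open>partition_on A Q\<close> \<open>partition_on A Q'\<close> insert.hyps
          by (auto simp: partition_on_def)
        have "insert a X \<in> insert (insert a X') (Q' - {X'})" using eq by blast
        then have "insert a X = insert a X'" using a by blast
        then have X: "X = X'" using a that by (metis insert_ident)
        have "insert a X \<notin> Q - {X}" "insert a X \<notin> Q' - {X}" using a by blast+
        then have "Q - {X} = Q' - {X}" using eq X by (metis insert_ident)
        then show ?thesis using X that by blast
      qed
      then show ?thesis unfolding inj_on_def by clarsimp
    qed
    have "card (?S (insert a A) (Suc j)) = card ?L + card ?R"
      unfolding 1 using finP[OF insert.hyps(1)] fin insert.hyps(1)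
      by (intro card_Un_disjoint 2 finite_imageI finite_SigmaI) auto
    also have "card ?L = Stirling (card A) j" using card_image[OF i1] insert.IH by simp
    also have "card ?R = card ?D" by (rule card_image[OF i2])
    also have "card ?D = (\<Sum>Q\<in>?S A (Suc j). card Q)"
      using finP fin insert.hyps by (intro card_SigmaI) auto
    also have "\<dots> = Suc j * Stirling (card A) (Suc j)"
      using insert.IH[of "Suc j"] by simp
    finally show ?thesis using Suc insert.hyps by simp
  qed
qed

end

theory Submission
  imports Defs
begin

text \<open>Expanding each power \<open>\<xi> i ^ p i\<close> in falling factorials with Stirling coefficients reduces the
  claim to the joint factorial moments of the multinomial distribution. These follow by adding
  one coordinate at a time: peeling off a coordinate leaves a sum of the same shape with a smaller
  \<open>m\<close>, and the remaining one-dimensional sum is the binomial theorem.\<close>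

section \<open>Falling factorials and the Stirling expansion of powers\<close>

lemma falling_factorial_0 [simp]: "falling_factorial a 0 = 1"
  by (simp add: falling_factorial_def)

lemma falling_factorial_Suc:
  "falling_factorial a (Suc k) = falling_factorial a k * (a - of_nat k)"
  by (simp add: falling_factorial_def)

lemma falling_factorial_add:
  "falling_factorial a (s + t) = falling_factorial a s * falling_factorial (a - of_nat s) t"
  by (induction t) (simp_all add: falling_factorial_Suc algebra_simps)

lemma falling_factorial_of_nat_eq_0:
  assumes "n < k"
  shows "falling_factorial (of_nat n :: 'a :: comm_ring_1) k = 0"
  unfolding falling_factorial_def by (rule prod_zero) (use assms in auto)

lemma falling_factorial_of_nat:
  assumes "k \<le> n"
  shows "falling_factorial (of_nat n :: 'a :: field_char_0) k = fact n / fact (n - k)"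
  using assms
proof (induction k)
  case (Suc k)
  then have "fact (n - k) = (of_nat n - of_nat k :: 'a) * fact (n - Suc k)"
    by (metis Suc_diff_Suc Suc_le_lessD fact_Suc of_nat_diff Suc_leD)
  moreover have "(of_nat n - of_nat k :: 'a) \<noteq> 0"
    using Suc.prems by simp
  ultimately show ?case
    using Suc by (simp add: falling_factorial_Suc)
qed simp

text \<open>Since \<open>falling_factorial a k * a = falling_factorial a (Suc k) + of_nat k *
  falling_factorial a k\<close>, passing from \<open>p\<close> to \<open>Suc p\<close> changes the
  coefficients by exactly the Stirling recurrence.\<close>

lemma power_eq_sum_Stirling_falling_factorial:
  "a ^ p = (\<Sum>k=0..p. of_nat (Stirling p k) * falling_factorial a k)"
proof (induction p)
  case (Suc p)
  let ?S = "\<lambda>k. of_nat (Stirling p k) :: 'a" and ?F = "falling_factorial a"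
  have "a ^ Suc p = (\<Sum>k=0..p. ?S k * ?F k) * a"
    by (simp only: Suc.IH[symmetric] power_Suc2)
  also have "\<dots> = (\<Sum>k=0..p. ?S k * ?F (Suc k)) + (\<Sum>k=0..p. of_nat k * ?S k * ?F k)"
    unfolding sum_distrib_right sum.distrib[symmetric]
    by (intro sum.cong) (simp_all add: falling_factorial_Suc algebra_simps)
  \<comment> \<open>The added top term is zero since \<open>Stirling p (Suc p) = 0\<close>; the term
    at \<open>0\<close>, dropped by the shift that follows, carries the factor
    \<open>0\<close>.\<close>
  also have "(\<Sum>k=0..p. of_nat k * ?S k * ?F k) = (\<Sum>k=0..Suc p. of_nat k * ?S k * ?F k)"
    by simp
  also have "\<dots> = (\<Sum>k=0..p. of_nat (Suc k) * ?S (Suc k) * ?F (Suc k))"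
    by (subst sum.atLeast0_atMost_Suc_shift) simp
  also have "(\<Sum>k=0..p. ?S k * ?F (Suc k)) + \<dots>
      = (\<Sum>k=0..Suc p. of_nat (Stirling (Suc p) k) * ?F k)"
    unfolding sum.distrib[symmetric] sum.atLeast0_atMost_Suc_shift[of _ p]
    by (simp add: algebra_simps)
  finally show ?case .
qed simp

section \<open>Joint factorial moments\<close>

text \<open>Only \<open>t\<close> with \<open>a \<le> t\<close> and \<open>t + b \<le> m\<close>
  contribute; there the factorials cancel and the binomial theorem remains. The bound
  \<open>N\<close> is separate from \<open>m\<close>, so that the range of summation stays fixed
  when \<open>multinomial_factorial_moment\<close> lowers \<open>m\<close>.\<close>

lemma sum_binomial_falling_factorial:
  fixes u v :: real
  assumes "m \<le> N"
  shows "(\<Sum>t=0..N. falling_factorial (real m) t * (falling_factorial (real t) a / fact t * u ^ t) *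
            (falling_factorial (real (m - t)) b * v ^ (m - t - b)))
       = falling_factorial (real m) (a + b) * u ^ a * (u + v) ^ (m - (a + b))"
  (is "sum ?f _ = _")
proof (cases "a + b \<le> m")
  case False
  have "sum ?f {0..N} = 0"
  proof (rule sum.neutral, rule ballI)
    fix t
    \<comment> \<open>The alternatives make the second, the first and the third falling factorial
      zero, respectively.\<close>
    have "t < a \<or> m < t \<or> m - t < b" using False by linarith
    then show "?f t = 0"
      by (elim disjE) (simp_all only: falling_factorial_of_nat_eq_0 mult_zero_left mult_zero_right div_0)
  qed
  moreover have "falling_factorial (real m) (a + b) = 0"
    using False by (intro falling_factorial_of_nat_eq_0) simp
  ultimately show ?thesis by (simp only: mult_zero_left)
next
  case True
  define n where "n = m - (a + b)"
  have m: "m = a + b + n" using True by (simp add: n_def)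
  \<comment> \<open>Here \<open>a + n\<close> is \<open>m - b\<close>, the largest \<open>t\<close>
    for which the first and third falling factorials are both nonzero.\<close>
  have "(\<Sum>t=0..N. ?f t) = (\<Sum>t=a..a+n. ?f t)"
  proof (rule sum.mono_neutral_right)
    show "\<forall>t\<in>{0..N} - {a..a + n}. ?f t = 0"
    proof
      fix t assume "t \<in> {0..N} - {a..a + n}"
      then have "t < a \<or> m < t \<or> m - t < b" using m by auto
      then show "?f t = 0"
        by (elim disjE) (simp_all only: falling_factorial_of_nat_eq_0 mult_zero_left mult_zero_right div_0)
    qed
  qed (use assms m in auto)
  also have "\<dots> = (\<Sum>s=0..n. ?f (s + a))"
    using sum.shift_bounds_cl_nat_ivl[of ?f 0 a n] by (simp add: add.commute)
  also have "\<dots> = (\<Sum>s=0..n. falling_factorial (real m) (a + b) * u ^ a *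
                    (of_nat (n choose s) * u ^ s * v ^ (n - s)))"
  proof (rule sum.cong)
    fix s assume "s \<in> {0..n}"
    then have s: "s \<le> n" by simp
    \<comment> \<open>Written as quotients of factorials, \<open>fact (s + a)\<close> and
      \<open>fact (b + (n - s))\<close> cancel, leaving
      \<open>fact m / (fact s * fact (n - s))\<close>, which is \<open>fact m / fact n\<close> times
      \<open>n choose s\<close>.\<close>
    have 1: "falling_factorial (real m) (s + a) = fact m / fact (b + (n - s))"
      using falling_factorial_of_nat[of "s + a" m, where 'a = real] s m by simp
    have 2: "falling_factorial (real (s + a)) a = fact (s + a) / fact s"
      using falling_factorial_of_nat[of a "s + a", where 'a = real] by simp
    have mt: "m - (s + a) = b + (n - s)" using s m by simp
    have 3: "falling_factorial (real (b + (n - s))) b = fact (b + (n - s)) / fact (n - s)"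
      using falling_factorial_of_nat[of b "b + (n - s)", where 'a = real] by simp
    have 4: "falling_factorial (real m) (a + b) = fact m / fact n"
      using falling_factorial_of_nat[of "a + b" m, where 'a = real] m by simp
    show "?f (s + a) = falling_factorial (real m) (a + b) * u ^ a *
                    (of_nat (n choose s) * u ^ s * v ^ (n - s))"
      unfolding 1 2 mt 3 4 binomial_fact[OF s] by (simp add: power_add field_simps)
  qed simp
  also have "\<dots> = falling_factorial (real m) (a + b) * u ^ a * (u + v) ^ n"
    by (simp add: binomial_ring sum_distrib_left atLeast0AtMost)
  finally show ?thesis by (simp add: n_def)
qed

lemma sum_PiE_insert:
  assumes "a \<notin> I"
  shows "(\<Sum>k\<in>PiE (insert a I) B. f k) = (\<Sum>t\<in>B a. \<Sum>k\<in>PiE I B. f (k(a := t)))"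
  unfolding PiE_insert_eq
  by (subst sum.reindex[OF inj_combinator[OF assms]])
     (simp add: case_prod_unfold sum.cartesian_product)

text \<open>Here \<open>y\<close> replaces the probability of the unrecorded category, because the normalization
  \<open>y + sum x I = 1\<close> is lost when a coordinate is dropped. The factor
  \<open>falling_factorial m (sum k I) = m! / (m - sum k I)!\<close> vanishes when the total exceeds \<open>m\<close>, which
  makes the range of summation a product set.\<close>

lemma multinomial_factorial_moment:
  fixes x :: "'i \<Rightarrow> real" and y :: real
  assumes "finite I" and "m \<le> N"
  shows "(\<Sum>k\<in>PiE I (\<lambda>_. {0..N}). falling_factorial (real m) (sum k I) * y ^ (m - sum k I) *
            (\<Prod>i\<in>I. falling_factorial (real (k i)) (j i) / fact (k i) * x i ^ k i))
       = falling_factorial (real m) (sum j I) * (\<Prod>i\<in>I. x i ^ j i) * (y + sum x I) ^ (m - sum j I)"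
  using assms
proof (induction I arbitrary: m rule: finite_induct)
  case (insert a I)
  let ?g = "\<lambda>k i. falling_factorial (real (k i)) (j i) / fact (k i) * x i ^ k i"
  let ?J = "sum j I" and ?X = "\<Prod>i\<in>I. x i ^ j i"
  let ?h = "\<lambda>t. falling_factorial (real t) (j a) / fact t * x a ^ t"
  \<comment> \<open>With count \<open>t\<close> at coordinate \<open>a\<close>, the rest is the same
    sum for \<open>m - t\<close>, covered by the induction hypothesis. For \<open>t > m\<close> the
    truncated subtraction is harmless: falling factorials of \<open>m\<close> vanish on both
    sides.\<close>
  have step: "(\<Sum>k\<in>PiE I (\<lambda>_. {0..N}). falling_factorial (real m) (t + sum k I) *
        y ^ (m - (t + sum k I)) * (?h t * (\<Prod>i\<in>I. ?g k i)))
     = ?X * (falling_factorial (real m) t * ?h t *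
        (falling_factorial (real (m - t)) ?J * (y + sum x I) ^ (m - t - ?J)))" for t
  proof (cases "t \<le> m")
    case True
    then have "falling_factorial (real m) (t + s)
        = falling_factorial (real m) t * falling_factorial (real (m - t)) s" for s
      by (simp add: falling_factorial_add of_nat_diff)
    then have "(\<Sum>k\<in>PiE I (\<lambda>_. {0..N}). falling_factorial (real m) (t + sum k I) *
        y ^ (m - (t + sum k I)) * (?h t * (\<Prod>i\<in>I. ?g k i)))
      = falling_factorial (real m) t * ?h t * (\<Sum>k\<in>PiE I (\<lambda>_. {0..N}).
          falling_factorial (real (m - t)) (sum k I) * y ^ (m - t - sum k I) * (\<Prod>i\<in>I. ?g k i))"
      by (simp add: sum_distrib_left mult_ac)
    also have "\<dots> = falling_factorial (real m) t * ?h t *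
        (falling_factorial (real (m - t)) ?J * ?X * (y + sum x I) ^ (m - t - ?J))"
      by (subst insert.IH) (use insert.prems in auto)
    finally show ?thesis by (simp add: mult_ac)
  next
    case False
    then show ?thesis by (simp add: falling_factorial_of_nat_eq_0)
  qed
  have upd: "sum (k(a := t)) I = sum k I" "(\<Prod>i\<in>I. ?g (k(a := t)) i) = (\<Prod>i\<in>I. ?g k i)"
    for k :: "'i \<Rightarrow> nat" and t
    using insert.hyps by (auto intro!: sum.cong prod.cong)
  have "(\<Sum>k\<in>PiE (insert a I) (\<lambda>_. {0..N}). falling_factorial (real m) (sum k (insert a I)) *
          y ^ (m - sum k (insert a I)) * (\<Prod>i\<in>insert a I. ?g k i))
      = (\<Sum>t=0..N. \<Sum>k\<in>PiE I (\<lambda>_. {0..N}). falling_factorial (real m) (t + sum k I) *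
          y ^ (m - (t + sum k I)) * (?h t * (\<Prod>i\<in>I. ?g k i)))"
    by (simp only: sum_PiE_insert[OF insert.hyps(2)] sum.insert[OF insert.hyps]
        prod.insert[OF insert.hyps] upd fun_upd_same)
  \<comment> \<open>The sum over \<open>t\<close> is the one-dimensional one with
    \<open>u = x a\<close>, \<open>v = y + sum x I\<close> and \<open>b = sum j I\<close>.\<close>
  also have "\<dots> = ?X * (falling_factorial (real m) (j a + ?J) * x a ^ j a *
      (x a + (y + sum x I)) ^ (m - (j a + ?J)))"
    by (simp only: step sum_distrib_left[symmetric] sum_binomial_falling_factorial[OF insert.prems])
  finally show ?case
    using insert.hyps by (simp add: add_ac mult_ac)
qed simp

section \<open>Expectations under the multinomial law\<close>

text \<open>Almost surely the counts lie in a finite set, so the integrand is almost everywhere a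
  finite combination of indicators. Restriction to \<open>{1..d}\<close> gives each count vector a
  unique representative in \<open>PiE\<close>.\<close>

lemma (in prob_space) multinomial_expectation:
  fixes g :: "(nat \<Rightarrow> nat) \<Rightarrow> real"
  assumes "multinomial_distributed M d m x \<xi>"
  shows "expectation (\<lambda>\<omega>. g (\<lambda>i\<in>{1..d}. \<xi> i \<omega>)) =
    (\<Sum>k\<in>{k \<in> PiE {1..d} (\<lambda>_. {0..m}). sum k {1..d} \<le> m}. multinomial_mass d m x k * g k)"
proof -
  let ?K = "{k \<in> PiE {1..d} (\<lambda>_. {0..m}). sum k {1..d} \<le> m}"
  let ?A = "\<lambda>k. {\<omega> \<in> space M. \<forall>i\<in>{1..d}. \<xi> i \<omega> = k i}"
  let ?R = "\<lambda>\<omega>. \<lambda>i\<in>{1..d}. \<xi> i \<omega>"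
  have finK: "finite ?K"
    by (rule finite_subset[of _ "PiE {1..d} (\<lambda>_. {0..m})"]) (auto intro: finite_PiE)
  have [measurable]: "\<And>i. i \<in> {1..d} \<Longrightarrow> \<xi> i \<in> M \<rightarrow>\<^sub>M count_space UNIV"
    and total: "AE \<omega> in M. (\<Sum>i\<in>{1..d}. \<xi> i \<omega>) \<le> m"
    and mass: "\<And>k. sum k {1..d} \<le> m \<Longrightarrow> prob (?A k) = multinomial_mass d m x k"
    using assms by (auto simp: multinomial_distributed_def)
  have A [measurable]: "?A k \<in> sets M" for k
    by measurable
  \<comment> \<open>The target is countable, so measurability reduces to preimages of singletons,
    the events \<open>?A k\<close>.\<close>
  have R: "?R \<in> M \<rightarrow>\<^sub>M count_space (PiE {1..d} (\<lambda>_. UNIV))"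
  proof (subst measurable_count_space_eq_countable)
    show "countable (PiE {1..d} (\<lambda>_. UNIV :: nat set))"
      by (intro countable_PiE) auto
    have "?R -` {k} \<inter> space M = ?A k" if "k \<in> PiE {1..d} (\<lambda>_. UNIV)" for k
      using that by (auto simp: fun_eq_iff PiE_def extensional_def)
    then show "?R \<in> space M \<rightarrow> PiE {1..d} (\<lambda>_. UNIV) \<and>
        (\<forall>k\<in>PiE {1..d} (\<lambda>_. UNIV). ?R -` {k} \<inter> space M \<in> sets M)"
      using A by auto
  qed
  have "expectation (\<lambda>\<omega>. g (?R \<omega>)) = expectation (\<lambda>\<omega>. \<Sum>k\<in>?K. g k * indicator (?A k) \<omega>)"
  proof (rule integral_cong_AE)
    show "(\<lambda>\<omega>. g (?R \<omega>)) \<in> borel_measurable M"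
      by (rule measurable_compose[OF R]) simp
    show "AE \<omega> in M. g (?R \<omega>) = (\<Sum>k\<in>?K. g k * indicator (?A k) \<omega>)"
      using total AE_space
    proof eventually_elim
      case (elim \<omega>)
      have "\<xi> i \<omega> \<le> m" if "i \<in> {1..d}" for i
        using elim(1) member_le_sum[of i "{1..d}" "\<lambda>i. \<xi> i \<omega>"] that by simp
      then have "?R \<omega> \<in> ?K" using elim(1) by auto
      \<comment> \<open>Members of \<open>?K\<close> are extensional, so agreement on
        \<open>{1..d}\<close> is equality and exactly one indicator is nonzero.\<close>
      moreover have "indicator (?A k) \<omega> = (if k = ?R \<omega> then 1 else 0 :: real)" if "k \<in> ?K" for k
      proof -
        have "k = ?R \<omega> \<longleftrightarrow> (\<forall>i\<in>{1..d}. \<xi> i \<omega> = k i)"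
          using that by (force simp: fun_eq_iff PiE_def extensional_def)
        then show ?thesis using elim(2) by (simp add: indicator_def)
      qed
      moreover from this have "(\<Sum>k\<in>?K. g k * indicator (?A k) \<omega>)
          = (\<Sum>k\<in>?K. if k = ?R \<omega> then g k else 0)"
        by (intro sum.cong) auto
      ultimately show ?case
        using finK by (simp only: sum.delta if_True)
    qed
  qed measurable
  also have "\<dots> = (\<Sum>k\<in>?K. g k * prob (?A k))"
    by (subst Bochner_Integration.integral_sum)
       (auto intro!: integrable_mult_right integrable_real_indicator simp: emeasure_eq_measure)
  also have "\<dots> = (\<Sum>k\<in>?K. multinomial_mass d m x k * g k)"
    using mass by (intro sum.cong) auto
  finally show ?thesis .
qed

theorem theorem1:
  fixes M :: "'a measure" and d m :: nat and x :: "nat \<Rightarrow> real"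
    and \<xi> :: "nat \<Rightarrow> 'a \<Rightarrow> nat" and p :: "nat \<Rightarrow> nat"
  assumes "prob_space M"
    and "d \<ge> 1" and "m \<ge> 1"
    and "x \<in> simplex_set d"
    and "multinomial_distributed M d m x \<xi>"
  shows "prob_space.expectation M (\<lambda>\<omega>. \<Prod>i\<in>{1..d}. real (\<xi> i \<omega>) ^ p i) =
    (\<Sum>k \<in> PiE {1..d} (\<lambda>i. {0..p i}).
       falling_factorial (real m) (\<Sum>i\<in>{1..d}. k i) *
       (\<Prod>i\<in>{1..d}. real (Stirling (p i) (k i)) * x i ^ k i))"
proof -
  interpret prob_space M by fact
  let ?I = "{1..d}" and ?B = "PiE {1..d} (\<lambda>_. {0..m})" and ?P = "PiE {1..d} (\<lambda>i. {0..p i})"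
  let ?K = "{k \<in> ?B. sum k ?I \<le> m}"
  \<comment> \<open>These factors of the mass depend on \<open>k\<close> only through its total. The
    falling factorial replaces \<open>fact m / fact (m - sum k ?I)\<close> and vanishes beyond
    \<open>m\<close>, so sums over \<open>?K\<close> extend to the box \<open>?B\<close>.\<close>
  define w where "w k = falling_factorial (real m) (sum k ?I) * (1 - sum x ?I) ^ (m - sum k ?I)"
    for k
  let ?ff = "\<lambda>k j i. falling_factorial (real (k i)) (j i)"
  have finB: "finite ?B" by (intro finite_PiE) auto
  have mass: "multinomial_mass d m x k = w k * (\<Prod>i\<in>?I. x i ^ k i / fact (k i))" if "k \<in> ?K" for k
    using that falling_factorial_of_nat[of "sum k ?I" m, where 'a = real]
    by (simp add: multinomial_mass_def w_def prod_dividef)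
  have w0: "w k = 0" if "k \<in> ?B - ?K" for k
    using that by (auto simp: w_def falling_factorial_of_nat_eq_0)
  have expand: "(\<Prod>i\<in>?I. real (k i) ^ p i)
      = (\<Sum>j\<in>?P. (\<Prod>i\<in>?I. real (Stirling (p i) (j i))) * (\<Prod>i\<in>?I. ?ff k j i))" for k
    by (subst power_eq_sum_Stirling_falling_factorial) (simp add: prod_sum_PiE prod.distrib)
  \<comment> \<open>With \<open>y = 1 - sum x ?I\<close> the base \<open>y + sum x ?I\<close> is
    \<open>1\<close>, so the last power in the factorial moment disappears.\<close>
  have moment: "(\<Sum>k\<in>?B. w k * (\<Prod>i\<in>?I. x i ^ k i / fact (k i)) * (\<Prod>i\<in>?I. ?ff k j i))
      = falling_factorial (real m) (sum j ?I) * (\<Prod>i\<in>?I. x i ^ j i)" for j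
  proof -
    have "(\<Prod>i\<in>?I. x i ^ k i / fact (k i)) * (\<Prod>i\<in>?I. ?ff k j i)
        = (\<Prod>i\<in>?I. ?ff k j i / fact (k i) * x i ^ k i)" for k
      by (simp add: mult.commute flip: prod.distrib)
    then show ?thesis
      using multinomial_factorial_moment[of ?I m m "1 - sum x ?I" j x]
      by (simp add: w_def mult.assoc)
  qed
  have "expectation (\<lambda>\<omega>. \<Prod>i\<in>?I. real (\<xi> i \<omega>) ^ p i)
      = (\<Sum>k\<in>?K. multinomial_mass d m x k * (\<Prod>i\<in>?I. real (k i) ^ p i))"
    using multinomial_expectation[OF assms(5), of "\<lambda>k. \<Prod>i\<in>?I. real (k i) ^ p i"] by simp
  also have "\<dots> = (\<Sum>k\<in>?B. w k * (\<Prod>i\<in>?I. x i ^ k i / fact (k i)) * (\<Prod>i\<in>?I. real (k i) ^ p i))"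
    by (rule sum.mono_neutral_cong_left) (use finB mass w0 in auto)
  \<comment> \<open>Expanding the powers and swapping the two finite sums leaves a factorial moment
    inside.\<close>
  also have "\<dots> = (\<Sum>j\<in>?P. (\<Prod>i\<in>?I. real (Stirling (p i) (j i))) *
      (\<Sum>k\<in>?B. w k * (\<Prod>i\<in>?I. x i ^ k i / fact (k i)) * (\<Prod>i\<in>?I. ?ff k j i)))"
    by (simp only: expand sum_distrib_left, subst sum.swap) (simp only: mult_ac)
  also have "\<dots> = (\<Sum>j\<in>?P. falling_factorial (real m) (sum j ?I) *
      (\<Prod>i\<in>?I. real (Stirling (p i) (j i)) * x i ^ j i))"
    by (simp only: moment prod.distrib) (simp only: mult_ac)
  finally show ?thesis .
qed

end
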